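(* Let $X$ be a real vector space, let $m\ge 2$, and let $\Omega_1,\ldots,\Omega_m$ be convex subsets of $X$ satisfying $$\bigcap_{i=1}^m\mathrm{core}(\Omega_i)\neq\emptyset.$$ Then $$N\Big(\bar{x};\bigcap_{i=1}^m\Omega_i\Big)=\sum_{i=1}^m N(\bar{x};\Omega_i)\quad\text{for all }\bar{x}\in\bigcap_{i=1}^m\Omega_i.$$
   Context: All vector spaces are real and carry no topology. $X'$ denotes the algebraic dual of $X$, i.e., the space of all linear functions $f\colon X\to\mathbb{R}$. For a nonempty set $\Omega\subset X$, the algebraic core is $\mathrm{core}(\Omega):=\{x\in\Omega\mid \forall v\in X\ \exists\delta>0\ \forall t\in\mathbb{R}\text{ with }|t|<\delta:\ x+tv\in\Omega\}$. For a nonempty convex set $\Omega\subset X$ and $\bar{x}\in\Omega$, the normal cone is $N(\bar{x};\Omega):=\{f\in X'\mid f(x-\bar{x})\le 0\text{ for all }x\in\Omega\}$. The sum of sets is the Minkowski sum in $X'$. *)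

theory Defs
  imports "HOL-Analysis.Convex" "HOL-Library.Set_Algebras" "HOL-Library.Function_Algebras"
begin

(* The pointwise addition on functions (Function_Algebras) is the addition of the algebraic
   dual, so the set addition of Set_Algebras on sets of functionals, and hence the big sum
   operator over such sets, is the Minkowski sum in the dual. *)

definition algebraic_dual :: "('a::real_vector \<Rightarrow> real) set" where
  "algebraic_dual = {f. linear f}"

definition algebraic_core :: "'a::real_vector set \<Rightarrow> 'a set" where
  "algebraic_core \<Omega> =
     {x \<in> \<Omega>. \<forall>v. \<exists>\<delta>>0. \<forall>t::real. \<bar>t\<bar> < \<delta> \<longrightarrow> x + t *\<^sub>R v \<in> \<Omega>}"

(* The notion is used only for x\<^sub>0 in the convex set \<Omega>; the formula is left unguarded
   and is not cut off to the empty set when x\<^sub>0 lies outside \<Omega>. *)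
definition normal_cone :: "'a::real_vector \<Rightarrow> 'a set \<Rightarrow> ('a \<Rightarrow> real) set" where
  "normal_cone x\<^sub>0 \<Omega> = {f \<in> algebraic_dual. \<forall>x\<in>\<Omega>. f (x - x\<^sub>0) \<le> 0}"

end

theory Submission
  imports Defs
begin

text \<open>
  For two sets \<open>A\<close>, \<open>B\<close> let \<open>K\<close>, \<open>L\<close> be the cones of directions from \<open>x\<^sub>0\<close> into them. Splitting a
  normal \<open>f\<close> of \<open>A \<inter> B\<close> amounts to a linear \<open>g\<close> with \<open>g \<le> 0\<close> on \<open>K\<close> and \<open>f \<le> g\<close> on \<open>L\<close>. Every
  linear minorant of the sublinear functional \<open>p v = inf {- f l | l \<in> L, v + l \<in> K}\<close> has both
  properties, and a minorant exists by the Hahn-Banach theorem; a point of \<open>B\<close> in the core of \<open>A\<close>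
  makes \<open>p\<close> finite. The case of \<open>m\<close> sets follows by induction.
\<close>

subsection \<open>Sublinear functionals\<close>

text \<open>The inequality for \<open>c > 0\<close> alone already forces \<open>p 0 = 0\<close> and equality.\<close>

definition sublinear :: "('a::real_vector \<Rightarrow> real) \<Rightarrow> bool" where
  "sublinear p \<longleftrightarrow>
     (\<forall>v w. p (v + w) \<le> p v + p w) \<and> (\<forall>c>0. \<forall>v. p (c *\<^sub>R v) \<le> c * p v)"

lemma sublinear_add: "sublinear p \<Longrightarrow> p (v + w) \<le> p v + p w"
  by (simp add: sublinear_def)

lemma sublinear_zero:
  assumes "sublinear p"
  shows "p 0 = 0"
proof -
  have "p 0 \<le> (1/2) * p 0"
    using assms unfolding sublinear_def
    by (metis half_gt_zero_iff scaleR_zero_right zero_less_one)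
  moreover have "p 0 \<le> p 0 + p 0"
    using sublinear_add[OF assms, of 0 0] by simp
  ultimately show ?thesis by simp
qed

lemma sublinear_scale:
  assumes "sublinear p" "c \<ge> 0"
  shows "p (c *\<^sub>R v) = c * p v"
proof (cases "c = 0")
  case False
  with assms have c: "c > 0" by simp
  have le: "p (d *\<^sub>R w) \<le> d * p w" if "d > 0" for d w
    using assms that by (simp add: sublinear_def)
  have "p v \<le> inverse c * p (c *\<^sub>R v)"
    using le[of "inverse c" "c *\<^sub>R v"] c by simp
  then have "c * p v \<le> p (c *\<^sub>R v)"
    using c by (simp add: field_simps)
  with le[OF c, of v] show ?thesis by simp
qed (use sublinear_zero[OF assms(1)] in simp)

lemma sublinear_minus: "sublinear p \<Longrightarrow> - p (- v) \<le> p v"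
  using sublinear_add[of p v "- v"] sublinear_zero[of p] by simp

text \<open>Shared by three infima: the modification of a minimal functional, the lower bound of a
  chain, and the functional \<open>p\<close> behind the sandwich. Subadditivity asks only for an
  element below \<open>r + s\<close>, since along a chain \<open>r\<close> and \<open>s\<close> may
  come from different functionals and \<open>r + s\<close> need not be a value of either.\<close>

lemma sublinear_Inf:
  fixes E :: "'a::real_vector \<Rightarrow> real set"
  assumes ne: "\<And>v. E v \<noteq> {}" and bdd: "\<And>v. bdd_below (E v)"
    and add: "\<And>v w r s. r \<in> E v \<Longrightarrow> s \<in> E w \<Longrightarrow> \<exists>u\<in>E (v + w). u \<le> r + s"
    and scale: "\<And>c v r. c > 0 \<Longrightarrow> r \<in> E v \<Longrightarrow> c * r \<in> E (c *\<^sub>R v)"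
  shows "sublinear (\<lambda>v. Inf (E v))"
  unfolding sublinear_def
proof (intro conjI allI impI)
  fix v w
  have *: "Inf (E (v + w)) \<le> r + s" if "r \<in> E v" "s \<in> E w" for r s
    using add[OF that] bdd by (meson cInf_lower order_trans)
  have "Inf (E (v + w)) - r \<le> Inf (E w)" if "r \<in> E v" for r
    using *[OF that] ne by (intro cInf_greatest) (auto simp: algebra_simps)
  then have "Inf (E (v + w)) - Inf (E w) \<le> Inf (E v)"
    using ne by (intro cInf_greatest) (auto simp: algebra_simps)
  then show "Inf (E (v + w)) \<le> Inf (E v) + Inf (E w)" by simp
next
  fix c :: real and v assume c: "c > 0"
  have "Inf (E (c *\<^sub>R v)) / c \<le> r" if "r \<in> E v" for r
    using cInf_lower[OF scale[OF c that] bdd] c by (simp add: field_simps)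
  then have "Inf (E (c *\<^sub>R v)) / c \<le> Inf (E v)"
    using ne by (intro cInf_greatest) auto
  then show "Inf (E (c *\<^sub>R v)) \<le> c * Inf (E v)"
    using c by (simp add: field_simps)
qed

text \<open>A minimal \<open>q\<close> is unchanged by the sublinear modification
  \<open>v \<mapsto> inf {q (v + t a) - t q a | t \<ge> 0} \<le> q\<close>, whose value at \<open>- a\<close> is at most \<open>- q a\<close>.\<close>

lemma minimal_sublinear_imp_linear:
  assumes q: "sublinear q" and min: "\<And>r. sublinear r \<Longrightarrow> r \<le> q \<Longrightarrow> r = q"
  shows "linear q"
proof -
  have neg: "q (- a) = - q a" for a
  proof -
    define E where "E v = {q (v + t *\<^sub>R a) - t * q a | t. t \<ge> 0}" for v
    have bdd: "bdd_below (E v)" for v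
    proof (rule bdd_belowI)
      fix r assume "r \<in> E v"
      then obtain t where t: "t \<ge> 0" "r = q (v + t *\<^sub>R a) - t * q a"
        by (auto simp: E_def)
      \<comment> \<open>Writing \<open>t a\<close> as \<open>(v + t a) + (- v)\<close> turns
        \<open>q (t a) = t q a\<close> into a lower bound that no longer depends on
        \<open>t\<close>.\<close>
      have "q (t *\<^sub>R a) \<le> q (v + t *\<^sub>R a) + q (- v)"
        using sublinear_add[OF q, of "v + t *\<^sub>R a" "- v"] by simp
      then show "- q (- v) \<le> r"
        using t sublinear_scale[OF q t(1), of a] by simp
    qed
    have "sublinear (\<lambda>v. Inf (E v))"
    proof (rule sublinear_Inf)
      show "E v \<noteq> {}" for v by (auto simp: E_def)
    next
      fix v w r s assume "r \<in> E v" "s \<in> E w"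
      then obtain t t' where t: "t \<ge> 0" "r = q (v + t *\<^sub>R a) - t * q a"
        "t' \<ge> 0" "s = q (w + t' *\<^sub>R a) - t' * q a"
        by (auto simp: E_def)
      let ?u = "q (v + w + (t + t') *\<^sub>R a) - (t + t') * q a"
      have "?u \<in> E (v + w)"
        using t unfolding E_def by (intro CollectI exI[of _ "t + t'"]) auto
      moreover have "?u \<le> r + s"
        using t sublinear_add[OF q, of "v + t *\<^sub>R a" "w + t' *\<^sub>R a"]
        by (simp add: algebra_simps)
      ultimately show "\<exists>u\<in>E (v + w). u \<le> r + s" by blast
    next
      fix c :: real and v r assume c: "c > 0" and "r \<in> E v"
      then obtain t where t: "t \<ge> 0" "r = q (v + t *\<^sub>R a) - t * q a"
        by (auto simp: E_def)
      have "c * r = q (c *\<^sub>R v + (c * t) *\<^sub>R a) - (c * t) * q a"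
        using c sublinear_scale[OF q, of c "v + t *\<^sub>R a"]
        by (simp add: t(2) scaleR_add_right right_diff_distrib)
      then show "c * r \<in> E (c *\<^sub>R v)"
        using c t(1) unfolding E_def by (intro CollectI exI[of _ "c * t"]) auto
    qed (rule bdd)
    moreover have "(\<lambda>v. Inf (E v)) \<le> q"
    proof (rule le_funI)
      fix v
      have "q v \<in> E v" unfolding E_def by (intro CollectI exI[of _ 0]) auto
      then show "Inf (E v) \<le> q v" using bdd by (rule cInf_lower)
    qed
    ultimately have "(\<lambda>v. Inf (E v)) = q" by (rule min)
    \<comment> \<open>The choice \<open>t = 1\<close> at \<open>- a\<close> leaves
      \<open>q 0 - q a\<close>.\<close>
    moreover have "- q a \<in> E (- a)"
      using sublinear_zero[OF q] unfolding E_def by (intro CollectI exI[of _ 1]) auto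
    ultimately have "q (- a) \<le> - q a"
      using cInf_lower[OF _ bdd] by metis
    with sublinear_minus[OF q, of a] show ?thesis by simp
  qed
  show ?thesis
  proof (rule linearI)
    fix v w
    \<comment> \<open>Oddness turns subadditivity at the negated vectors into
      superadditivity.\<close>
    have "q (- v + - w) \<le> q (- v) + q (- w)" by (rule sublinear_add[OF q])
    also have "- v + - w = - (v + w)" by simp
    finally have "q v + q w \<le> q (v + w)" by (simp add: neg del: minus_add_distrib)
    with sublinear_add[OF q, of v w] show "q (v + w) = q v + q w" by simp
  next
    fix c v
    show "q (c *\<^sub>R v) = c *\<^sub>R q v"
    proof (cases "c \<ge> 0")
      case False
      then have "q ((- c) *\<^sub>R v) = (- c) * q v" by (intro sublinear_scale[OF q]) simp
      then show ?thesis using neg[of "c *\<^sub>R v"] by simp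
    qed (simp add: sublinear_scale[OF q])
  qed
qed

text \<open>Zorn's lemma gives a minimal element among the sublinear functionals below
  \<open>p\<close>, and minimality forces linearity.\<close>

theorem Hahn_Banach_sublinear:
  assumes p: "sublinear p"
  obtains g where "linear g" "g \<le> p"
proof -
  define S where "S = {q. sublinear q \<and> q \<le> p}"
  have "\<exists>q\<in>S. \<forall>r\<in>S. r \<le> q \<longrightarrow> r = q"
  \<comment> \<open>The order is reversed, so a maximal element for it is a minimal functional and
    the bound sought for a chain is a lower one.\<close>
  proof (rule predicate_Zorn[where P = "\<lambda>q r. r \<le> q"])
    show "partial_order_on S (relation_of (\<lambda>q r. r \<le> q) S)"
      by (rule partial_order_on_relation_ofI) auto
  next
    fix C assume C: "C \<in> Chains (relation_of (\<lambda>q r. r \<le> q) S)"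
    then have sub: "C \<subseteq> S" and total: "\<And>q r. q \<in> C \<Longrightarrow> r \<in> C \<Longrightarrow> q \<le> r \<or> r \<le> q"
      unfolding Chains_def relation_of_def by auto
    show "\<exists>u\<in>S. \<forall>a\<in>C. u \<le> a"
    proof (cases "C = {}")
      case True
      with p show ?thesis by (auto simp: S_def)
    next
      case False
      \<comment> \<open>The pointwise infimum of the chain will be its lower bound.\<close>
      define E where "E v = (\<lambda>q. q v) ` C" for v
      have bdd: "bdd_below (E v)" for v
      proof (rule bdd_belowI)
        fix r assume "r \<in> E v"
        then obtain q where q: "q \<in> C" "r = q v" by (auto simp: E_def)
        with sub have "sublinear q" "q (- v) \<le> p (- v)" by (auto simp: S_def le_fun_def)
        \<comment> \<open>Here \<open>q v\<close> is at least \<open>- q (- v)\<close>, hence at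
          least \<open>- p (- v)\<close>, which is the same for all members of the chain.\<close>
        with sublinear_minus[of q v] q show "- p (- v) \<le> r" by simp
      qed
      have lower: "(\<lambda>v. Inf (E v)) \<le> q" if "q \<in> C" for q
        using that bdd by (auto intro!: le_funI cInf_lower simp: E_def)
      have "sublinear (\<lambda>v. Inf (E v))"
      proof (rule sublinear_Inf)
        show "E v \<noteq> {}" for v using False by (simp add: E_def)
      next
        fix v w r s assume "r \<in> E v" "s \<in> E w"
        then obtain q q' where q: "q \<in> C" "r = q v" "q' \<in> C" "s = q' w"
          by (auto simp: E_def)
        \<comment> \<open>The smaller of the two functionals lies below both, so its own
          subadditivity serves the mixed sum.\<close>
        obtain q'' where q'': "q'' \<in> C" "q'' \<le> q" "q'' \<le> q'"
          using total q by blast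
        have "q'' (v + w) \<le> q'' v + q'' w"
          using q'' sub by (auto simp: S_def intro: sublinear_add)
        also have "\<dots> \<le> r + s"
          using q q'' by (auto simp: le_fun_def intro: add_mono)
        finally show "\<exists>u\<in>E (v + w). u \<le> r + s"
          using q'' by (auto simp: E_def)
      next
        fix c :: real and v r assume "c > 0" "r \<in> E v"
        then obtain q where q: "q \<in> C" "r = q v" by (auto simp: E_def)
        with sub \<open>c > 0\<close> have "c * r = q (c *\<^sub>R v)"
          by (auto simp: S_def sublinear_scale)
        with q show "c * r \<in> E (c *\<^sub>R v)" by (auto simp: E_def)
      qed (rule bdd)
      moreover have "(\<lambda>v. Inf (E v)) \<le> p"
      proof -
        obtain q where "q \<in> C" using False by blast
        with sub have "q \<le> p" by (auto simp: S_def)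
        with lower[OF \<open>q \<in> C\<close>] show ?thesis by (rule order_trans)
      qed
      ultimately show ?thesis
        using lower unfolding S_def by blast
    qed
  qed
  then obtain q where "sublinear q" "q \<le> p" "\<And>r. sublinear r \<Longrightarrow> r \<le> q \<Longrightarrow> r = q"
    unfolding S_def by (blast intro: order_trans)
  then show thesis
    using that minimal_sublinear_imp_linear by blast
qed

subsection \<open>Sandwich theorem for convex cones\<close>

text \<open>Absorption is used twice: for \<open>v\<close> it provides an admissible
  \<open>l = s e\<close>, so \<open>E v\<close> is nonempty, and for \<open>- v\<close> it bounds
  \<open>E v\<close> below. Both bounds required of \<open>g\<close> are then read off single
  elements of \<open>E\<close>.\<close>

lemma cone_sandwich:
  fixes f :: "'a::real_vector \<Rightarrow> real"
  assumes K_add: "\<And>v w. v \<in> K \<Longrightarrow> w \<in> K \<Longrightarrow> v + w \<in> K"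
    and K_scale: "\<And>c v. c > 0 \<Longrightarrow> v \<in> K \<Longrightarrow> c *\<^sub>R v \<in> K"
    and L_add: "\<And>v w. v \<in> L \<Longrightarrow> w \<in> L \<Longrightarrow> v + w \<in> L"
    and L_scale: "\<And>c v. c > 0 \<Longrightarrow> v \<in> L \<Longrightarrow> c *\<^sub>R v \<in> L"
    and "e \<in> L" and absorb: "\<And>v. \<exists>s>0. v + s *\<^sub>R e \<in> K"
    and "0 \<in> K" "0 \<in> L"
    and f: "linear f" "\<And>v. v \<in> K \<Longrightarrow> v \<in> L \<Longrightarrow> f v \<le> 0"
  obtains g where "linear g" "\<And>v. v \<in> K \<Longrightarrow> g v \<le> 0" "\<And>v. v \<in> L \<Longrightarrow> f v \<le> g v"
proof -
  define E where "E v = {- f l | l. l \<in> L \<and> v + l \<in> K}" for v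
  have bdd: "bdd_below (E v)" for v
  proof -
    \<comment> \<open>Adding \<open>- v + s e\<close> to \<open>v + l\<close> cancels
      \<open>v\<close>, so \<open>l + s e\<close> lies in both cones and \<open>f\<close> is
      nonpositive there.\<close>
    obtain s where s: "s > 0" "- v + s *\<^sub>R e \<in> K" using absorb by blast
    have "f (s *\<^sub>R e) \<le> - f l" if "l \<in> L" "v + l \<in> K" for l
    proof -
      have "l + s *\<^sub>R e \<in> L" using that s \<open>e \<in> L\<close> by (intro L_add L_scale)
      moreover have "(v + l) + (- v + s *\<^sub>R e) \<in> K" using that(2) s(2) by (rule K_add)
      then have "l + s *\<^sub>R e \<in> K" by (simp add: algebra_simps)
      ultimately show ?thesis using f(2)[of "l + s *\<^sub>R e"] linear_add[OF f(1)] by simp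
    qed
    then show ?thesis unfolding E_def by (intro bdd_belowI[of _ "f (s *\<^sub>R e)"]) blast
  qed
  have "sublinear (\<lambda>v. Inf (E v))"
  proof (rule sublinear_Inf)
    fix v
    show "E v \<noteq> {}" using absorb[of v] L_scale[OF _ \<open>e \<in> L\<close>] unfolding E_def by blast
  next
    fix v w r s assume "r \<in> E v" "s \<in> E w"
    then obtain l l' where l: "l \<in> L" "v + l \<in> K" "r = - f l"
      "l' \<in> L" "w + l' \<in> K" "s = - f l'"
      by (auto simp: E_def)
    have "(v + l) + (w + l') \<in> K" using l(2,5) by (rule K_add)
    then have "v + w + (l + l') \<in> K" by (simp add: algebra_simps)
    then have "r + s \<in> E (v + w)"
      using l L_add linear_add[OF f(1), of l l']
      unfolding E_def by (intro CollectI exI[of _ "l + l'"]) auto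
    then show "\<exists>u\<in>E (v + w). u \<le> r + s" by blast
  next
    fix c :: real and v r assume c: "c > 0" and "r \<in> E v"
    then obtain l where l: "l \<in> L" "v + l \<in> K" "r = - f l" by (auto simp: E_def)
    have "c *\<^sub>R v + c *\<^sub>R l \<in> K"
      using K_scale[OF c l(2)] by (simp add: scaleR_add_right)
    then show "c * r \<in> E (c *\<^sub>R v)"
      using l L_scale[OF c] linear_scale[OF f(1), of c l]
      unfolding E_def by (intro CollectI exI[of _ "c *\<^sub>R l"]) auto
  qed (rule bdd)
  then obtain g where g: "linear g" "g \<le> (\<lambda>v. Inf (E v))"
    by (rule Hahn_Banach_sublinear)
  have le: "g v \<le> r" if "r \<in> E v" for v r
    using g(2) cInf_lower[OF that bdd] by (meson le_funD order_trans)
  show thesis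
  proof
    \<comment> \<open>For \<open>v\<close> in \<open>K\<close> the choice \<open>l = 0\<close> puts
      the value 0 into \<open>E v\<close>.\<close>
    show "g v \<le> 0" if "v \<in> K" for v
      using that \<open>0 \<in> L\<close> linear_0[OF f(1)]
      by (intro le) (auto simp: E_def intro!: exI[of _ 0])
  next
    fix v assume "v \<in> L"
    \<comment> \<open>At \<open>- v\<close> the choice \<open>l = v\<close> is admissible because
      \<open>- v + v = 0\<close> lies in \<open>K\<close>.\<close>
    then have "g (- v) \<le> - f v"
      using \<open>0 \<in> K\<close> by (intro le) (auto simp: E_def intro!: exI[of _ v])
    then show "f v \<le> g v" using linear_neg[OF g(1), of v] by simp
  qed (rule g(1))
qed

subsection \<open>Normal cones of intersections\<close>

text \<open>This is the union of the dilates \<open>t (A - x\<^sub>0)\<close> over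
  \<open>t > 0\<close>, the cone generated by \<open>A - x\<^sub>0\<close> when
  \<open>x\<^sub>0\<close> lies in \<open>A\<close>.\<close>

definition feasible_directions :: "'a::real_vector \<Rightarrow> 'a set \<Rightarrow> 'a set" where
  "feasible_directions x\<^sub>0 A = {v. \<exists>r>0. x\<^sub>0 + r *\<^sub>R v \<in> A}"

lemma feasible_directionsI: "r > 0 \<Longrightarrow> x\<^sub>0 + r *\<^sub>R v \<in> A \<Longrightarrow> v \<in> feasible_directions x\<^sub>0 A"
  by (auto simp: feasible_directions_def)

lemma diff_mem_feasible_directions: "x \<in> A \<Longrightarrow> x - x\<^sub>0 \<in> feasible_directions x\<^sub>0 A"
  by (rule feasible_directionsI[of 1]) auto

lemma feasible_directions_scale:
  assumes "c > 0" "v \<in> feasible_directions x\<^sub>0 A"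
  shows "c *\<^sub>R v \<in> feasible_directions x\<^sub>0 A"
proof -
  obtain r where "r > 0" "x\<^sub>0 + r *\<^sub>R v \<in> A"
    using assms by (auto simp: feasible_directions_def)
  with assms(1) show ?thesis by (intro feasible_directionsI[of "r / c"]) auto
qed

text \<open>The point lies on the segment from \<open>x\<^sub>0\<close>, with weight
  \<open>s / r\<close>. Hence directions with different step lengths can be followed with their
  common minimum.\<close>

lemma convex_shrink:
  assumes "convex A" "x\<^sub>0 \<in> A" "x\<^sub>0 + r *\<^sub>R v \<in> A" "0 \<le> s" "s \<le> r" "r > 0"
  shows "x\<^sub>0 + s *\<^sub>R v \<in> A"
proof -
  have "(1 - s / r) *\<^sub>R x\<^sub>0 + (s / r) *\<^sub>R (x\<^sub>0 + r *\<^sub>R v) \<in> A"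
    using assms by (intro convexD_alt) auto
  also have "(1 - s / r) *\<^sub>R x\<^sub>0 + (s / r) *\<^sub>R (x\<^sub>0 + r *\<^sub>R v) = x\<^sub>0 + s *\<^sub>R v"
    using assms by (simp add: algebra_simps)
  finally show ?thesis .
qed

lemma feasible_directions_add:
  assumes A: "convex A" and v: "v \<in> feasible_directions x\<^sub>0 A"
    and w: "w \<in> feasible_directions x\<^sub>0 A" and x0: "x\<^sub>0 \<in> A"
  shows "v + w \<in> feasible_directions x\<^sub>0 A"
proof -
  obtain r s where r: "r > 0" "x\<^sub>0 + r *\<^sub>R v \<in> A" and s: "s > 0" "x\<^sub>0 + s *\<^sub>R w \<in> A"
    using v w by (auto simp: feasible_directions_def)
  define u where "u = min r s"
  have u: "u > 0" "u \<le> r" "u \<le> s" using r s by (auto simp: u_def)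
  have "x\<^sub>0 + u *\<^sub>R v \<in> A" "x\<^sub>0 + u *\<^sub>R w \<in> A"
    using convex_shrink[OF A x0 r(2)] convex_shrink[OF A x0 s(2)] r(1) s(1) u by auto
  then have "(1/2) *\<^sub>R (x\<^sub>0 + u *\<^sub>R v) + (1/2) *\<^sub>R (x\<^sub>0 + u *\<^sub>R w) \<in> A"
    using A by (intro convexD) auto
  also have "(1/2) *\<^sub>R (x\<^sub>0 + u *\<^sub>R v) + (1/2) *\<^sub>R (x\<^sub>0 + u *\<^sub>R w) =
    ((1/2) *\<^sub>R x\<^sub>0 + (1/2) *\<^sub>R x\<^sub>0) + (u / 2) *\<^sub>R (v + w)"
    by (simp add: algebra_simps)
  also have "(1/2) *\<^sub>R x\<^sub>0 + (1/2) *\<^sub>R x\<^sub>0 = x\<^sub>0"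
    by (simp flip: scaleR_add_left)
  finally show ?thesis using u by (intro feasible_directionsI[of "u / 2"]) auto
qed

text \<open>A short step \<open>t v\<close> from the core point stays in \<open>A\<close>. Seen from
  \<open>x\<^sub>0\<close> it is the direction \<open>(c - x\<^sub>0) + t v\<close>; dividing by
  \<open>t\<close> gives \<open>s = 1 / t\<close>.\<close>

lemma feasible_directions_absorb:
  assumes "c \<in> algebraic_core A"
  shows "\<exists>s>0. v + s *\<^sub>R (c - x\<^sub>0) \<in> feasible_directions x\<^sub>0 A"
proof -
  obtain \<delta> where \<delta>: "\<delta> > 0" "\<And>t. \<bar>t\<bar> < \<delta> \<Longrightarrow> c + t *\<^sub>R v \<in> A"
    using assms unfolding algebraic_core_def by blast
  define t where "t = \<delta> / 2"
  have t: "t > 0" "c + t *\<^sub>R v \<in> A" using \<delta> by (auto simp: t_def)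
  have "x\<^sub>0 + t *\<^sub>R (v + (1 / t) *\<^sub>R (c - x\<^sub>0)) = c + t *\<^sub>R v"
    using t by (simp add: algebra_simps)
  with t have "v + (1 / t) *\<^sub>R (c - x\<^sub>0) \<in> feasible_directions x\<^sub>0 A"
    by (intro feasible_directionsI[of t]) auto
  with t show ?thesis by (intro exI[of _ "1 / t"]) simp
qed

lemma normal_cone_add_subset:
  "normal_cone x\<^sub>0 A + normal_cone x\<^sub>0 B \<subseteq> normal_cone x\<^sub>0 (A \<inter> B)"
proof
  fix h assume "h \<in> normal_cone x\<^sub>0 A + normal_cone x\<^sub>0 B"
  then obtain f g where fg: "h = f + g" "f \<in> normal_cone x\<^sub>0 A" "g \<in> normal_cone x\<^sub>0 B"
    by (rule set_plus_elim)
  then have "linear f" "linear g" by (auto simp: normal_cone_def algebraic_dual_def)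
  then have "linear (f + g)"
    unfolding plus_fun_def by (rule linear_compose_add)
  with fg show "h \<in> normal_cone x\<^sub>0 (A \<inter> B)"
    by (auto simp: normal_cone_def algebraic_dual_def intro!: add_nonpos_nonpos)
qed

text \<open>The condition on \<open>c\<close> is asymmetric so that the lemma can be iterated: in
  the induction \<open>B\<close> is an intersection, and membership of \<open>c\<close> in it is
  immediate, with no statement about its core.\<close>

lemma normal_cone_Int:
  assumes A: "convex A" and B: "convex B" and x0: "x\<^sub>0 \<in> A" "x\<^sub>0 \<in> B"
    and c: "c \<in> algebraic_core A" "c \<in> B"
  shows "normal_cone x\<^sub>0 (A \<inter> B) = normal_cone x\<^sub>0 A + normal_cone x\<^sub>0 B"
proof
  show "normal_cone x\<^sub>0 (A \<inter> B) \<subseteq> normal_cone x\<^sub>0 A + normal_cone x\<^sub>0 B"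
  proof
    fix f assume "f \<in> normal_cone x\<^sub>0 (A \<inter> B)"
    then have f: "linear f" "\<And>x. x \<in> A \<Longrightarrow> x \<in> B \<Longrightarrow> f (x - x\<^sub>0) \<le> 0"
      by (auto simp: normal_cone_def algebraic_dual_def)
    let ?K = "feasible_directions x\<^sub>0 A" and ?L = "feasible_directions x\<^sub>0 B"
    have f_le: "f v \<le> 0" if "v \<in> ?K" "v \<in> ?L" for v
    proof -
      obtain r s where r: "r > 0" "x\<^sub>0 + r *\<^sub>R v \<in> A" and s: "s > 0" "x\<^sub>0 + s *\<^sub>R v \<in> B"
        using \<open>v \<in> ?K\<close> \<open>v \<in> ?L\<close> by (auto simp: feasible_directions_def)
      define u where "u = min r s"
      have u: "u > 0" "u \<le> r" "u \<le> s" using r s by (auto simp: u_def)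
      have "x\<^sub>0 + u *\<^sub>R v \<in> A" "x\<^sub>0 + u *\<^sub>R v \<in> B"
        using convex_shrink[OF A x0(1) r(2)] convex_shrink[OF B x0(2) s(2)] r(1) s(1) u by auto
      then have "f (u *\<^sub>R v) \<le> 0" using f(2)[of "x\<^sub>0 + u *\<^sub>R v"] by simp
      then have "u * f v \<le> 0" using linear_scale[OF f(1), of u v] by simp
      with u show ?thesis by (simp add: mult_le_0_iff)
    qed
    have zero: "0 \<in> ?K" "0 \<in> ?L"
      using x0 diff_mem_feasible_directions[of x\<^sub>0 _ x\<^sub>0] by auto
    obtain g where g: "linear g" "\<And>v. v \<in> ?K \<Longrightarrow> g v \<le> 0" "\<And>v. v \<in> ?L \<Longrightarrow> f v \<le> g v"
    proof (rule cone_sandwich[of ?K ?L "c - x\<^sub>0" f])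
      show "\<exists>s>0. v + s *\<^sub>R (c - x\<^sub>0) \<in> ?K" for v
        using c(1) by (rule feasible_directions_absorb)
    qed (use feasible_directions_add[OF A _ _ x0(1)] feasible_directions_add[OF B _ _ x0(2)]
        feasible_directions_scale diff_mem_feasible_directions[OF c(2)] zero f(1) f_le in auto)
    have "g \<in> normal_cone x\<^sub>0 A"
      using g diff_mem_feasible_directions[of _ A x\<^sub>0]
      by (auto simp: normal_cone_def algebraic_dual_def)
    \<comment> \<open>The lower bound \<open>f \<le> g\<close> on the directions into
      \<open>B\<close> is exactly normality of \<open>f - g\<close>.\<close>
    moreover have "f - g \<in> normal_cone x\<^sub>0 B"
      using f(1) g linear_compose_sub[of f g] diff_mem_feasible_directions[of _ B x\<^sub>0]
      by (auto simp: normal_cone_def algebraic_dual_def fun_diff_def)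
    ultimately have "g + (f - g) \<in> normal_cone x\<^sub>0 A + normal_cone x\<^sub>0 B"
      by (rule set_plus_intro)
    then show "f \<in> normal_cone x\<^sub>0 A + normal_cone x\<^sub>0 B" by simp
  qed
qed (rule normal_cone_add_subset)

text \<open>Base case of the induction, where the empty intersection is the whole space and the
  empty sum is the zero set \<open>{0}\<close>. A linear functional nonpositive at \<open>v\<close>
  and at \<open>- v\<close> vanishes at \<open>v\<close>.\<close>

lemma normal_cone_UNIV: "normal_cone x\<^sub>0 UNIV = {0}"
proof -
  have "f = 0" if "f \<in> normal_cone x\<^sub>0 UNIV" for f
  proof
    fix v
    have f: "linear f" "\<And>x. f (x - x\<^sub>0) \<le> 0"
      using that by (auto simp: normal_cone_def algebraic_dual_def)
    then have "f v \<le> 0" "f (- v) \<le> 0"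
      using f(2)[of "x\<^sub>0 + v"] f(2)[of "x\<^sub>0 - v"] by auto
    then show "f v = 0 v" using linear_neg[OF f(1), of v] by simp
  qed
  moreover have "0 \<in> normal_cone x\<^sub>0 UNIV"
    by (auto simp: normal_cone_def algebraic_dual_def zero_fun_def linear_zero)
  ultimately show ?thesis by blast
qed

lemma normal_cone_INT:
  assumes "finite I" "\<And>i. i \<in> I \<Longrightarrow> convex (\<Omega> i)"
    and "\<And>i. i \<in> I \<Longrightarrow> c \<in> algebraic_core (\<Omega> i)" "\<And>i. i \<in> I \<Longrightarrow> x\<^sub>0 \<in> \<Omega> i"
  shows "normal_cone x\<^sub>0 (\<Inter>i\<in>I. \<Omega> i) = (\<Sum>i\<in>I. normal_cone x\<^sub>0 (\<Omega> i))"
  using assms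
proof (induction I rule: finite_induct)
  case empty
  show ?case by (simp add: normal_cone_UNIV)
next
  case (insert j I)
  have "normal_cone x\<^sub>0 (\<Omega> j \<inter> (\<Inter>i\<in>I. \<Omega> i)) =
    normal_cone x\<^sub>0 (\<Omega> j) + normal_cone x\<^sub>0 (\<Inter>i\<in>I. \<Omega> i)"
  proof (rule normal_cone_Int)
    show "convex (\<Inter>i\<in>I. \<Omega> i)" using insert.prems by (intro convex_INT) auto
    show "c \<in> (\<Inter>i\<in>I. \<Omega> i)" using insert.prems(2) by (auto simp: algebraic_core_def)
  qed (use insert.prems in auto)
  with insert show ?case by simp
qed

theorem theorem5p4:
  fixes \<Omega> :: "nat \<Rightarrow> 'a::real_vector set" and m :: nat
  assumes "m \<ge> 2"
    and "\<And>i. i \<in> {1..m} \<Longrightarrow> convex (\<Omega> i)"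
    and "(\<Inter>i\<in>{1..m}. algebraic_core (\<Omega> i)) \<noteq> {}"
  shows "\<forall>x\<^sub>0 \<in> (\<Inter>i\<in>{1..m}. \<Omega> i).
           normal_cone x\<^sub>0 (\<Inter>i\<in>{1..m}. \<Omega> i) = (\<Sum>i\<in>{1..m}. normal_cone x\<^sub>0 (\<Omega> i))"
proof
  fix x\<^sub>0 assume x0: "x\<^sub>0 \<in> (\<Inter>i\<in>{1..m}. \<Omega> i)"
  obtain c where "c \<in> (\<Inter>i\<in>{1..m}. algebraic_core (\<Omega> i))" using assms(3) by blast
  with x0 assms(2) show
    "normal_cone x\<^sub>0 (\<Inter>i\<in>{1..m}. \<Omega> i) = (\<Sum>i\<in>{1..m}. normal_cone x\<^sub>0 (\<Omega> i))"
    by (intro normal_cone_INT[where c = c]) auto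
qed

end
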